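(* Let $N_i=\{(1,1),(-1,-1),(0,-1),(1,-1),(0,-2)\}$. For all $\ell,\ell'\ge 1$ and every crossing gate $c$ on the uniform $\ell\times\ell'$ grid with neighborhood $N_i$, with designated North, South, West and East cells $n,s,w,e$, there is a directed path in the North-toppling graph $G_n$ of $c$ from $n$ to $s$ that crosses the West-toppling graph $G_w$ of $c$ at least twice; that is, there are at least two distinct pairs $(\alpha,\beta)$, where $\alpha$ is an edge of the path and $\beta$ is an edge of $G_w$, such that $\alpha$ and $\beta$ cross.
   Context: Sandpile on a uniform grid. For $\ell,\ell'\ge 1$ let $V=\{1,\dots,\ell\}\times\{1,\dots,\ell'\}$ be the set of cells; the first coordinate increases to the East and the second coordinate increases to the North. The West, East, South and North edges of the grid are the sets of cells with first coordinate $1$, first coordinate $\ell$, second coordinate $1$, second coordinate $\ell'$, respectively; corners are the cells lying on two edges of different axes. Fix a finite neighborhood $N\subset\mathbb{Z}^2\setminus\{(0,0)\}$, the same for all cells. A configuration is a function $c:V\to\mathbb{N}$. A cell $u$ is stable in $c$ if $c(u)<|N|$ and unstable otherwise; $c$ is stable if all cells are stable. In one parallel step $T$, all unstable cells $u$ topple simultaneously: each loses $|N|$ grains and sends one grain to each $u+\delta$ with $\delta\in N$; grains sent outside $V$ are lost. Starting from a configuration $c$, a cell $u$ topples at time $t\ge0$ if $u$ is unstable in $T^t(c)$. (On a uniform grid, when one grain is added to a stable configuration at a cell on an edge of the grid, every cell topples at most once.) Crossing gate. A crossing gate is a stable configuration $c$ together with designated cells $n$ (a non-corner cell of the North edge),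 $s$ (on the South edge), $w$ (a non-corner cell of the West edge) and $e$ (on the East edge) such that: starting from $c$ with one grain added at $n$, the cell $s$ topples and no cell of the East edge topples; and starting from $c$ with one grain added at $w$, the cell $e$ topples and no cell of the South edge topples. Toppling graphs. The North-toppling graph $G_n$ (resp. West-toppling graph $G_w$) of a crossing gate $c$ is the directed graph whose vertices are the cells that topple when one grain is added to $c$ at $n$ (resp. at $w$), with a directed edge from $u$ to $v$ if and only if $v-u\in N$ and $v$ topples strictly after $u$. Crossing edges. To an edge $(u,v)$ associate the segment in $\mathbb{R}^2$ joining $u$ to $v$, with the endpoint $v$ included and the starting point $u$ excluded. Two edges cross if their associated segments intersect. *)

theory Defs
  imports "HOL-Analysis.Analysis" "Graph_Theory.Graph_Theory"
begin

type_synonym cell = "int \<times> int"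

(* Only the values on the grid matter: nothing below looks at a configuration outside it. *)
type_synonym config = "cell \<Rightarrow> nat"

definition grid :: "nat \<Rightarrow> nat \<Rightarrow> cell set" where
  "grid l l' = {1..int l} \<times> {1..int l'}"

definition west_edge :: "nat \<Rightarrow> nat \<Rightarrow> cell set" where
  "west_edge l l' = {u \<in> grid l l'. fst u = 1}"

definition east_edge :: "nat \<Rightarrow> nat \<Rightarrow> cell set" where
  "east_edge l l' = {u \<in> grid l l'. fst u = int l}"

definition south_edge :: "nat \<Rightarrow> nat \<Rightarrow> cell set" where
  "south_edge l l' = {u \<in> grid l l'. snd u = 1}"

definition north_edge :: "nat \<Rightarrow> nat \<Rightarrow> cell set" where
  "north_edge l l' = {u \<in> grid l l'. snd u = int l'}"

definition corners :: "nat \<Rightarrow> nat \<Rightarrow> cell set" where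
  "corners l l' = (west_edge l l' \<union> east_edge l l') \<inter> (south_edge l l' \<union> north_edge l l')"

definition unstable :: "cell set \<Rightarrow> config \<Rightarrow> cell \<Rightarrow> bool" where
  "unstable N c u \<longleftrightarrow> card N \<le> c u"

definition stable :: "cell set \<Rightarrow> nat \<Rightarrow> nat \<Rightarrow> config \<Rightarrow> bool" where
  "stable N l l' c \<longleftrightarrow> (\<forall>u \<in> grid l l'. \<not> unstable N c u)"

definition step :: "cell set \<Rightarrow> nat \<Rightarrow> nat \<Rightarrow> config \<Rightarrow> config" where
  "step N l l' c = (\<lambda>u.
     if u \<in> grid l l' then
       (if unstable N c u then c u - card N else c u)
         + card {v \<in> grid l l'. unstable N c v \<and> u - v \<in> N}
     else 0)"

definition add_grain :: "config \<Rightarrow> cell \<Rightarrow> config" where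
  "add_grain c x = c(x := c x + 1)"

definition topples_at :: "cell set \<Rightarrow> nat \<Rightarrow> nat \<Rightarrow> config \<Rightarrow> nat \<Rightarrow> cell \<Rightarrow> bool" where
  "topples_at N l l' c t u \<longleftrightarrow> u \<in> grid l l' \<and> unstable N ((step N l l' ^^ t) c) u"

definition topples :: "cell set \<Rightarrow> nat \<Rightarrow> nat \<Rightarrow> config \<Rightarrow> cell \<Rightarrow> bool" where
  "topples N l l' c u \<longleftrightarrow> (\<exists>t. topples_at N l l' c t u)"

(* Meant for evolutions in which every cell topples at most once, so that the toppling
   times are unique; with the neighborhood N_i below, this is the case after adding a grain
   on the border of a stable configuration. *)
definition topples_after :: "cell set \<Rightarrow> nat \<Rightarrow> nat \<Rightarrow> config \<Rightarrow> cell \<Rightarrow> cell \<Rightarrow> bool" where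
  "topples_after N l l' c v u \<longleftrightarrow>
     (\<exists>t t'. topples_at N l l' c t u \<and> topples_at N l l' c t' v \<and> t < t')"

definition crossing_gate ::
  "cell set \<Rightarrow> nat \<Rightarrow> nat \<Rightarrow> config \<Rightarrow> cell \<Rightarrow> cell \<Rightarrow> cell \<Rightarrow> cell \<Rightarrow> bool" where
  "crossing_gate N l l' c n s w e \<longleftrightarrow>
     stable N l l' c \<and>
     n \<in> north_edge l l' - corners l l' \<and> s \<in> south_edge l l' \<and>
     w \<in> west_edge l l' - corners l l' \<and> e \<in> east_edge l l' \<and>
     topples N l l' (add_grain c n) s \<and>
     (\<forall>u \<in> east_edge l l'. \<not> topples N l l' (add_grain c n) u) \<and>
     topples N l l' (add_grain c w) e \<and>
     (\<forall>u \<in> south_edge l l'. \<not> topples N l l' (add_grain c w) u)"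

(* The North-toppling (West-toppling) graph is obtained for x = n (x = w). *)
definition toppling_graph ::
  "cell set \<Rightarrow> nat \<Rightarrow> nat \<Rightarrow> config \<Rightarrow> cell \<Rightarrow> cell pair_pre_digraph" where
  "toppling_graph N l l' c x =
     \<lparr>pverts = {u. topples N l l' (add_grain c x) u},
      parcs = {(u, v). topples N l l' (add_grain c x) u \<and> topples N l l' (add_grain c x) v \<and>
                       v - u \<in> N \<and> topples_after N l l' (add_grain c x) v u}\<rparr>"

definition point :: "cell \<Rightarrow> real \<times> real" where
  "point u = (real_of_int (fst u), real_of_int (snd u))"

definition edge_segment :: "cell \<times> cell \<Rightarrow> (real \<times> real) set" where
  "edge_segment a = closed_segment (point (fst a)) (point (snd a)) - {point (fst a)}"

definition edges_cross :: "cell \<times> cell \<Rightarrow> cell \<times> cell \<Rightarrow> bool" where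
  "edges_cross a b \<longleftrightarrow> edge_segment a \<inter> edge_segment b \<noteq> {}"

definition N_i :: "cell set" where
  "N_i = {(1, 1), (-1, -1), (0, -1), (1, -1), (0, -2)}"

end

theory Submission
  imports Defs
begin

text \<open>
  Let \<open>A\<close> (\<open>B\<close>) be the set of cells that topple in the North (West) avalanche only. Apart from
  the start cell, every \<open>u \<in> A\<close> has more predecessors in \<open>A\<close> than there are cells of \<open>B\<close> that can
  send it a grain, and symmetrically. So there are paths from \<open>n\<close> to \<open>s\<close> inside \<open>A\<close> and from \<open>w\<close>
  to \<open>e\<close> inside \<open>B\<close>, and they cross by Fashoda's theorem without sharing a cell.

  Suppose that every path from \<open>n\<close> to \<open>s\<close> inside \<open>A\<close> has only one crossing pair. Going through
  the ways in which two edges with disjoint ends can cross, the path must cross by an edge from \<open>u\<close>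
  to \<open>v = u + (1, -1)\<close> with \<open>u + (1, 0) \<in> B\<close>. As \<open>u + (1, 0)\<close> can send a grain to \<open>v\<close>, \<open>v\<close> has a
  second predecessor \<open>z \<in> A\<close>. Rerouting the path through \<open>z\<close> yields a path whose crossing lies
  before \<open>z\<close>, so the toppling time of the head of the crossing edge descends forever.
\<close>

section \<open>Avalanches started on the border\<close>

text \<open>The cells of \<open>S\<close> with an edge into \<open>u\<close>; if each cell of
  \<open>S\<close> topples once, the cardinality is the number of grains that \<open>u\<close>
  receives.\<close>

definition in_cells :: "cell set \<Rightarrow> cell set \<Rightarrow> cell \<Rightarrow> cell set" where
  "in_cells N S u = {v \<in> S. u - v \<in> N}"

lemma finite_in_cells: "finite S \<Longrightarrow> finite (in_cells N S u)"
  by (simp add: in_cells_def)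

lemma inj_on_diff_cell: "inj_on (\<lambda>v. u - v) (S :: cell set)"
  by (rule inj_onI) simp

lemma card_in_cells_le:
  assumes "finite N"
  shows "card (in_cells N S u) \<le> card N"
proof (rule card_inj_on_le[OF inj_on_diff_cell _ assms])
  show "(\<lambda>v. u - v) ` in_cells N S u \<subseteq> N"
    by (auto simp: in_cells_def)
qed

text \<open>The map \<open>v \<mapsto> u - v\<close> injects the senders into \<open>N\<close> and
  misses \<open>d\<close>. This is what keeps a start cell on the border from toppling
  twice.\<close>

lemma card_in_cells_less:
  assumes "finite N" "d \<in> N" "u - d \<notin> S"
  shows "card (in_cells N S u) < card N"
proof -
  have "(\<lambda>v. u - v) ` in_cells N S u \<subseteq> N - {d}"
    using assms(3) by (auto simp: in_cells_def)
  then have "card (in_cells N S u) \<le> card (N - {d})"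
    using assms(1) by (intro card_inj_on_le[OF inj_on_diff_cell]) auto
  also have "\<dots> < card N"
    using assms by (intro card_Diff1_less) auto
  finally show ?thesis .
qed

lemma finite_grid: "finite (grid l l')"
  by (simp add: grid_def)

definition topple_count :: "cell set \<Rightarrow> nat \<Rightarrow> nat \<Rightarrow> config \<Rightarrow> nat \<Rightarrow> cell \<Rightarrow> nat" where
  "topple_count N l l' c t u = (\<Sum>s<t. of_bool (topples_at N l l' c s u))"

lemma card_eq_sum_of_bool:
  "finite S \<Longrightarrow> card {v \<in> S. P v} = (\<Sum>v\<in>S. of_bool (P v))"
  by (simp add: of_bool_def Int_def flip: sum.inter_filter)

text \<open>Conservation of grains: content plus grains lost equals initial content plus grains
  received. The form is additive because subtraction on \<open>nat\<close> truncates.\<close>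

lemma step_iterate:
  assumes u: "u \<in> grid l l'"
  shows "(step N l l' ^^ t) c u + card N * topple_count N l l' c t u =
    c u + (\<Sum>v \<in> in_cells N (grid l l') u. topple_count N l l' c t v)"
proof (induction t)
  case 0
  then show ?case by (simp add: topple_count_def)
next
  case (Suc t)
  define d where "d = (step N l l' ^^ t) c"
  have count_Suc: "topple_count N l l' c (Suc t) v =
      topple_count N l l' c t v + of_bool (topples_at N l l' c t v)" for v
    by (simp add: topple_count_def)
  have "card {v \<in> grid l l'. unstable N d v \<and> u - v \<in> N} =
      card {v \<in> in_cells N (grid l l') u. topples_at N l l' c t v}"
    by (rule arg_cong[where f = card]) (auto simp: in_cells_def topples_at_def d_def)
  also have "\<dots> = (\<Sum>v \<in> in_cells N (grid l l') u. of_bool (topples_at N l l' c t v))"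
    by (intro card_eq_sum_of_bool finite_in_cells finite_grid)
  finally have sent: "card {v \<in> grid l l'. unstable N d v \<and> u - v \<in> N} =
      (\<Sum>v \<in> in_cells N (grid l l') u. of_bool (topples_at N l l' c t v))" .
  have "(step N l l' ^^ Suc t) c u + card N * of_bool (topples_at N l l' c t u) =
      d u + card {v \<in> grid l l'. unstable N d v \<and> u - v \<in> N}"
    using u by (auto simp: step_def topples_at_def unstable_def d_def)
  then show ?case
    using Suc.IH by (simp add: count_Suc sum.distrib sent d_def[symmetric] algebra_simps)
qed

text \<open>
  The cells of \<open>T\<close> topple exactly once, at the times \<open>\<tau>\<close>, and the other cells of \<open>V\<close> never do.
\<close>

locale avalanche =
  fixes N V :: "cell set" and c :: config and x :: cell and T :: "cell set" and \<tau> :: "cell \<Rightarrow> nat"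
  assumes finite_V: "finite V" and T_subset: "T \<subseteq> V"
    and stable_V: "\<And>u. u \<in> V \<Longrightarrow> c u < card N"
    and toppled: "\<And>u. u \<in> T \<Longrightarrow>
      card N \<le> c u + of_bool (u = x) + card (in_cells N {v \<in> T. \<tau> v < \<tau> u} u)"
    and untoppled: "\<And>u. u \<in> V \<Longrightarrow> u \<notin> T \<Longrightarrow>
      c u + of_bool (u = x) + card (in_cells N T u) < card N"

text \<open>At a cell that never topples the value of \<open>LEAST\<close> carries no
  information.\<close>

definition toppling_time :: "cell set \<Rightarrow> nat \<Rightarrow> nat \<Rightarrow> config \<Rightarrow> cell \<Rightarrow> nat" where
  "toppling_time N l l' c u = (LEAST t. topples_at N l l' c t u)"

text \<open>Being on the border is encoded by \<open>d\<close>: the cell \<open>x - d\<close>, which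
  would send a grain to \<open>x\<close> along \<open>d\<close>, lies off the grid.\<close>

locale border_grain =
  fixes N :: "cell set" and l l' :: nat and c :: config and x d :: cell
  assumes fin_N: "finite N" and st: "stable N l l' c" and x: "x \<in> grid l l'"
    and d: "d \<in> N" "x - d \<notin> grid l l'"
begin

abbreviation "c0 \<equiv> add_grain c x"
abbreviation "V \<equiv> grid l l'"

lemma add_grain_eq: "c0 u = c u + of_bool (u = x)"
  by (simp add: add_grain_def)

lemma stable_less: "u \<in> V \<Longrightarrow> c u < card N"
  using st by (auto simp: stable_def unstable_def)

text \<open>
  A cell toppling twice would have to receive a grain from each of its neighbours and one more;
  only the start cell could do without the extra grain, but it lacks a neighbour.
\<close>

lemma topple_count_le_1: "u \<in> V \<Longrightarrow> topple_count N l l' c0 t u \<le> 1"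
proof (induction t arbitrary: u)
  case 0
  then show ?case by (simp add: topple_count_def)
next
  case (Suc t)
  have count_Suc: "topple_count N l l' c0 (Suc t) u =
      topple_count N l l' c0 t u + of_bool (topples_at N l l' c0 t u)"
    by (simp add: topple_count_def)
  have "\<not> (topples_at N l l' c0 t u \<and> topple_count N l l' c0 t u = 1)"
  proof
    assume A: "topples_at N l l' c0 t u \<and> topple_count N l l' c0 t u = 1"
    then have "card N \<le> (step N l l' ^^ t) c0 u"
      by (simp add: topples_at_def unstable_def)
    \<comment> \<open>One \<open>card N\<close> is present at time \<open>t\<close>, the other was
      lost in the first toppling.\<close>
    then have "2 * card N \<le> c0 u + (\<Sum>v \<in> in_cells N V u. topple_count N l l' c0 t v)"
      using step_iterate[OF Suc.prems, where N = N and t = t and c = c0] A by simp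
    also have "(\<Sum>v \<in> in_cells N V u. topple_count N l l' c0 t v) \<le> (\<Sum>v \<in> in_cells N V u. 1)"
      by (intro sum_mono Suc.IH) (auto simp: in_cells_def)
    finally have le: "2 * card N \<le> c u + of_bool (u = x) + card (in_cells N V u)"
      by (simp add: add_grain_eq)
    show False
    proof (cases "u = x")
      case True
      then have "card (in_cells N V u) < card N"
        using card_in_cells_less[OF fin_N d] by simp
      then show False using le stable_less[OF Suc.prems] True by simp
    next
      case False
      then show False using le stable_less[OF Suc.prems] card_in_cells_le[OF fin_N, of V u] by simp
    qed
  qed
  then show ?case using Suc.IH[OF Suc.prems] count_Suc
    by (cases "topples_at N l l' c0 t u") auto
qed

lemma topples_at_unique:
  assumes "topples_at N l l' c0 t u" "topples_at N l l' c0 t' u"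
  shows "t = t'"
proof (rule ccontr)
  assume "t \<noteq> t'"
  have "u \<in> V" using assms(1) by (simp add: topples_at_def)
  have "2 = (\<Sum>s\<in>{t, t'}. of_bool (topples_at N l l' c0 s u) :: nat)"
    using assms \<open>t \<noteq> t'\<close> by simp
  also have "\<dots> \<le> topple_count N l l' c0 (Suc (max t t')) u"
    unfolding topple_count_def by (intro sum_mono2) auto
  also have "\<dots> \<le> 1" by (rule topple_count_le_1) fact
  finally show False by simp
qed

abbreviation "T \<equiv> {u. topples N l l' c0 u}"
abbreviation "\<tau> \<equiv> toppling_time N l l' c0"

lemma topples_at_iff: "topples_at N l l' c0 t u \<longleftrightarrow> u \<in> T \<and> t = \<tau> u"
proof -
  have *: "topples_at N l l' c0 (\<tau> u) u" if "topples_at N l l' c0 s u" for s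
    unfolding toppling_time_def using that by (rule LeastI)
  show ?thesis
    using * topples_at_unique[of _ u] by (auto simp only: topples_def mem_Collect_eq)
qed

lemma topples_after_iff:
  "topples_after N l l' c0 v u \<longleftrightarrow> u \<in> T \<and> v \<in> T \<and> \<tau> u < \<tau> v"
  by (auto simp: topples_after_def topples_at_iff)

lemma topple_count_eq: "topple_count N l l' c0 t u = of_bool (u \<in> T \<and> \<tau> u < t)"
proof -
  have "topple_count N l l' c0 t u = (\<Sum>s<t. if s = \<tau> u then of_bool (u \<in> T) else 0)"
    unfolding topple_count_def topples_at_iff by (intro sum.cong) auto
  then show ?thesis by simp
qed

lemma step_iterate_eq:
  assumes u: "u \<in> V"
  shows "(step N l l' ^^ t) c0 u + card N * of_bool (u \<in> T \<and> \<tau> u < t) =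
    c u + of_bool (u = x) + card (in_cells N {v \<in> T. \<tau> v < t} u)"
proof -
  have "T \<subseteq> V" by (auto simp: topples_def topples_at_def)
  have "(\<Sum>v \<in> in_cells N V u. of_bool (v \<in> T \<and> \<tau> v < t)) =
      card {v \<in> in_cells N V u. v \<in> T \<and> \<tau> v < t}"
    by (rule card_eq_sum_of_bool[symmetric]) (intro finite_in_cells finite_grid)
  also have "{v \<in> in_cells N V u. v \<in> T \<and> \<tau> v < t} = in_cells N {v \<in> T. \<tau> v < t} u"
    using \<open>T \<subseteq> V\<close> by (auto simp: in_cells_def)
  finally show ?thesis
    using step_iterate[OF u, where N = N and t = t and c = c0] unfolding topple_count_eq add_grain_eq by simp
qed

text \<open>Both inequalities come from conservation of grains: at time \<open>\<tau> u\<close>,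
  when \<open>u\<close> has lost nothing yet, and at a time when every sender that topples has done
  so.\<close>

lemma avalanche_topples: "avalanche N V c x T \<tau>"
proof
  show "finite V" by (rule finite_grid)
  show TV: "T \<subseteq> V" by (auto simp: topples_def topples_at_def)
  show "c u < card N" if "u \<in> V" for u
    using that by (rule stable_less)
  show "card N \<le> c u + of_bool (u = x) + card (in_cells N {v \<in> T. \<tau> v < \<tau> u} u)"
    if "u \<in> T" for u
  proof -
    have "topples_at N l l' c0 (\<tau> u) u" using that by (simp add: topples_at_iff)
    then have "card N \<le> (step N l l' ^^ \<tau> u) c0 u"
      by (simp add: topples_at_def unstable_def)
    then show ?thesis
      using step_iterate_eq[of u "\<tau> u"] TV that by auto
  qed
  show "c u + of_bool (u = x) + card (in_cells N T u) < card N"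
    if "u \<in> V" "u \<notin> T" for u
  proof -
    \<comment> \<open>By time \<open>t\<close> all grains meant for \<open>u\<close> have arrived. A
      bound exists since only finitely many cells can send to \<open>u\<close>, whatever
      \<open>\<tau>\<close> is off \<open>T\<close>.\<close>
    obtain t where t: "\<And>v. v \<in> in_cells N V u \<Longrightarrow> \<tau> v < t"
    proof -
      have "finite (\<tau> ` in_cells N V u)" by (intro finite_imageI finite_in_cells finite_grid)
      then obtain t where "\<forall>k \<in> \<tau> ` in_cells N V u. k < t"
        using finite_nat_set_iff_bounded by blast
      then show thesis using that by blast
    qed
    have "in_cells N {v \<in> T. \<tau> v < t} u = in_cells N T u"
      using t TV by (auto simp: in_cells_def)
    moreover have "\<not> topples_at N l l' c0 t u" using that by (simp add: topples_at_iff)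
    then have "(step N l l' ^^ t) c0 u < card N"
      using that by (simp add: topples_at_def unstable_def)
    ultimately show ?thesis
      using step_iterate_eq[of u t] that by simp
  qed
qed

lemma parcs_toppling_graph:
  "parcs (toppling_graph N l l' c x) = {(u, v). u \<in> T \<and> v \<in> T \<and> v - u \<in> N \<and> \<tau> u < \<tau> v}"
  by (auto simp: toppling_graph_def topples_after_iff)

end

section \<open>Crossing edges\<close>

lemma edge_segmentE:
  assumes "z \<in> edge_segment (u, v)"
  obtains t where "0 < t" "t \<le> 1"
    "fst z = real_of_int (fst u) + t * real_of_int (fst v - fst u)"
    "snd z = real_of_int (snd u) + t * real_of_int (snd v - snd u)"
proof -
  from assms obtain t where t: "0 \<le> t" "t \<le> 1" "z = (1 - t) *\<^sub>R point u + t *\<^sub>R point v"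
    and "z \<noteq> point u"
    by (auto simp: edge_segment_def in_segment)
  then have "0 < t" by (cases "t = 0") auto
  then show thesis
    using t by (intro that[of t]) (auto simp: point_def algebra_simps)
qed

lemma point_eq_iff [simp]: "point u = point v \<longleftrightarrow> u = v"
  by (auto simp: point_def prod_eq_iff)

lemma head_in_edge_segment: "u \<noteq> v \<Longrightarrow> point v \<in> edge_segment (u, v)"
  by (simp add: edge_segment_def)

lemma N_i_iff:
  "d \<in> N_i \<longleftrightarrow> d = (1, 1) \<or> d = (- 1, - 1) \<or> d = (0, - 1) \<or> d = (1, - 1) \<or> d = (0, - 2)"
  by (auto simp: N_i_def)

text \<open>\<open>(0, - 2)\<close> is the only non-primitive vector in \<open>N_i\<close>, so only
  edges of this direction have a lattice point in their interior, namely the midpoint.\<close>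

lemma point_in_edge_segment:
  assumes "v - u \<in> N_i" "point p \<in> edge_segment (u, v)"
  shows "p = v \<or> v = u - (0, 2) \<and> p = u - (0, 1)"
proof -
  obtain t where t: "0 < t" "t \<le> 1"
    "real_of_int (fst p) = real_of_int (fst u) + t * real_of_int (fst v - fst u)"
    "real_of_int (snd p) = real_of_int (snd u) + t * real_of_int (snd v - snd u)"
    using edge_segmentE[OF assms(2)] by (auto simp: point_def)
  obtain a b where v: "v = u + (a, b)" "(a, b) \<in> N_i"
    using assms(1) by (metis add.commute diff_add_cancel surj_pair)
  obtain i j where p: "p = u + (i, j)"
    by (metis add.commute diff_add_cancel surj_pair)
  have "real_of_int i = t * a" "real_of_int j = t * b"
    using t p v(1) by auto
  moreover have "a = 1 \<and> b = 1 \<or> a = - 1 \<and> b = - 1 \<or> a = 0 \<and> b = - 1 \<or> a = 1 \<and> b = - 1 \<or>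
      a = 0 \<and> b = - 2"
    using v(2) by (auto simp: N_i_iff)
  ultimately have "i = a \<and> j = b \<or> a = 0 \<and> b = - 2 \<and> i = 0 \<and> j = - 1"
    using t(1,2) by (elim disjE conjE; hypsubst; simp; linarith)
  then show ?thesis
    using p v by (cases u) (auto simp: numeral_eq_Suc)
qed

lemma mid_in_edge_segment: "point (u - (0, 1)) \<in> edge_segment (u, u - (0, 2))"
proof -
  have "point (u - (0, 1)) \<in> closed_segment (point u) (point (u - (0, 2)))"
    by (auto simp: in_segment point_def field_simps intro!: exI[of _ "1/2"])
  then show ?thesis
    by (simp add: edge_segment_def point_def)
qed

text \<open>Here \<open>(i, j)\<close> leads from the first tail to the second,
  \<open>(a, b)\<close> and \<open>(a', b')\<close> are the directions, and \<open>t\<close>,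
  \<open>t'\<close> locate the common point. Without shared ends, the edges are the two diagonals of
  a unit square, or one has direction \<open>(0, - 2)\<close> and an end of the other is its
  midpoint.\<close>

lemma edge_offsets_cross:
  fixes t t' :: real and i j a b a' b' :: int
  assumes N: "(a, b) \<in> N_i" "(a', b') \<in> N_i"
    and t: "0 < t" "t \<le> 1" "0 < t'" "t' \<le> 1"
    and eq: "i + t' * a' = t * a" "j + t' * b' = t * b"
    and ne: "(i, j) \<noteq> (0, 0)" "(i, j) \<noteq> (a, b)" "(i + a', j + b') \<noteq> (0, 0)" "(i + a', j + b') \<noteq> (a, b)"
  shows "(a, b) = (1, - 1) \<and> (a', b') = (1, 1) \<and> (i, j) = (0, - 1) \<or>
    (a, b) = (1, - 1) \<and> (a', b') = (- 1, - 1) \<and> (i, j) = (1, 0) \<or>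
    (a', b') = (1, - 1) \<and> (a, b) = (1, 1) \<and> (i, j) = (0, 1) \<or>
    (a', b') = (1, - 1) \<and> (a, b) = (- 1, - 1) \<and> (i, j) = (- 1, 0) \<or>
    (a, b) = (0, - 2) \<and> ((i, j) = (0, - 1) \<or> (i + a', j + b') = (0, - 1)) \<or>
    (a', b') = (0, - 2) \<and> ((i, j) = (0, 1) \<or> (i - a, j - b) = (0, 1))"
proof -
  have ab: "a = 1 \<and> b = 1 \<or> a = - 1 \<and> b = - 1 \<or> a = 0 \<and> b = - 1 \<or> a = 1 \<and> b = - 1 \<or>
      a = 0 \<and> b = - 2"
    using N(1) by (auto simp: N_i_iff)
  have ab': "a' = 1 \<and> b' = 1 \<or> a' = - 1 \<and> b' = - 1 \<or> a' = 0 \<and> b' = - 1 \<or> a' = 1 \<and> b' = - 1 \<or>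
      a' = 0 \<and> b' = - 2"
    using N(2) by (auto simp: N_i_iff)
  \<comment> \<open>With \<open>i\<close> bounded, fixing \<open>i\<close> and both directions
    leaves finitely many problems, each linear in \<open>t\<close>, \<open>t'\<close> and
    \<open>j\<close>.\<close>
  have "- 3 < real_of_int i \<and> real_of_int i < 3"
    using ab ab' eq(1) t by (elim disjE conjE; hypsubst; simp; linarith)
  then have i: "i = - 2 \<or> i = - 1 \<or> i = 0 \<or> i = 1 \<or> i = 2" by arith
  show ?thesis
    using ab ab' eq t ne i unfolding prod.inject
    by (elim disjE conjE; hypsubst) (simp_all, linarith)
qed

text \<open>In the first case \<open>u - (0, 1)\<close> and \<open>u + (1, 0)\<close> are the
  remaining corners of the unit square with diagonal \<open>(u, v)\<close>. The second case
  exchanges the roles and keeps only the corner used later.\<close>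

lemma edges_cross_cases [consumes 4]:
  assumes "edges_cross (u, v) (u', v')"
    and N: "v - u \<in> N_i" "v' - u' \<in> N_i"
    and ne: "{u, v} \<inter> {u', v'} = {}"
  obtains
    "v = u + (1, - 1)" "(u', v') = (u - (0, 1), u + (1, 0)) \<or> (u', v') = (u + (1, 0), u - (0, 1))"
  | "v' = u' + (1, - 1)" "u' + (1, 0) \<in> {u, v}"
  | "v = u - (0, 2)" "u - (0, 1) \<in> {u', v'}"
  | "v' = u' - (0, 2)" "u' - (0, 1) \<in> {u, v}"
proof -
  obtain z where z: "z \<in> edge_segment (u, v)" "z \<in> edge_segment (u', v')"
    using assms(1) by (auto simp: edges_cross_def)
  obtain t where t: "0 < t" "t \<le> 1"
    "fst z = real_of_int (fst u) + t * real_of_int (fst v - fst u)"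
    "snd z = real_of_int (snd u) + t * real_of_int (snd v - snd u)"
    using z(1) by (rule edge_segmentE)
  obtain t' where t': "0 < t'" "t' \<le> 1"
    "fst z = real_of_int (fst u') + t' * real_of_int (fst v' - fst u')"
    "snd z = real_of_int (snd u') + t' * real_of_int (snd v' - snd u')"
    using z(2) by (rule edge_segmentE)
  obtain x y where u: "u = (x, y)" by fastforce
  define i j where "i = fst u' - x" and "j = snd u' - y"
  then have u': "u' = (x + i, y + j)" by simp
  define a b where "a = fst v - x" and "b = snd v - y"
  then have v: "v = (x + a, y + b)" by simp
  define a' b' where "a' = fst v' - x - i" and "b' = snd v' - y - j"
  then have v': "v' = (x + i + a', y + j + b')" by simp
  note uv = u v u' v'
  have "(a, b) \<in> N_i" "(a', b') \<in> N_i"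
    using N by (simp_all add: uv)
  moreover have "i + t' * a' = t * a" "j + t' * b' = t * b"
    using t t' by (simp_all add: uv)
  moreover have "(i, j) \<noteq> (0, 0)" "(i, j) \<noteq> (a, b)" "(i + a', j + b') \<noteq> (0, 0)"
    "(i + a', j + b') \<noteq> (a, b)"
    using ne by (auto simp: uv)
  ultimately consider
      "(a, b) = (1, - 1)" "(a', b') = (1, 1)" "(i, j) = (0, - 1)"
    | "(a, b) = (1, - 1)" "(a', b') = (- 1, - 1)" "(i, j) = (1, 0)"
    | "(a', b') = (1, - 1)" "(a, b) = (1, 1)" "(i, j) = (0, 1)"
    | "(a', b') = (1, - 1)" "(a, b) = (- 1, - 1)" "(i, j) = (- 1, 0)"
    | "(a, b) = (0, - 2)" "(i, j) = (0, - 1) \<or> (i + a', j + b') = (0, - 1)"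
    | "(a', b') = (0, - 2)" "(i, j) = (0, 1) \<or> (i - a, j - b) = (0, 1)"
    using edge_offsets_cross[of a b a' b' t t' i j] t(1,2) t'(1,2) by argo
  then show thesis
  proof cases
    case 1
    then show ?thesis by (intro that(1)) (auto simp: uv)
  next
    case 2
    then show ?thesis by (intro that(1)) (auto simp: uv)
  next
    case 3
    then show ?thesis by (intro that(2)) (auto simp: uv)
  next
    case 4
    then show ?thesis by (intro that(2)) (auto simp: uv)
  next
    case 5
    then show ?thesis by (intro that(3)) (auto simp: uv)
  next
    case 6
    then show ?thesis by (intro that(4)) (auto simp: uv algebra_simps)
  qed
qed

section \<open>Walks as planar paths\<close>

text \<open>Segments are concatenated. Each half-open edge omits its tail, which is the head of the
  previous edge, so only the first point of the walk may be missed; hence the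
  \<open>insert\<close>.\<close>

lemma polyline_path:
  assumes "pcas u p v"
  obtains g :: "real \<Rightarrow> real \<times> real" where "path g" "pathstart g = point u" "pathfinish g = point v"
    "path_image g = insert (point u) (\<Union>e \<in> set p. edge_segment e)"
  using assms
proof (induction p arbitrary: u thesis)
  case Nil
  show ?case
  proof (rule Nil.prems(1))
    show "path (linepath (point u) (point u))"
      "pathstart (linepath (point u) (point u)) = point u"
      "pathfinish (linepath (point u) (point u)) = point v"
      using Nil.prems(2) by (simp_all only: path_linepath pathstart_linepath pathfinish_linepath pcas.simps)
  qed (simp only: path_image_linepath, simp)
next
  case (Cons e p)
  then have e: "fst e = u" "pcas (snd e) p v" by auto
  obtain g where g: "path g" "pathstart g = point (snd e)" "pathfinish g = point v"
    "path_image g = insert (point (snd e)) (\<Union>e \<in> set p. edge_segment e)"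
    using Cons.IH[OF _ e(2)] by blast
  have eq: "closed_segment (point u) (point (snd e)) = insert (point u) (edge_segment e)"
    by (auto simp: edge_segment_def e)
  show ?case
  proof (rule Cons.prems(1)[of "linepath (point u) (point (snd e)) +++ g"])
    have "path_image (linepath (point u) (point (snd e)) +++ g) =
        closed_segment (point u) (point (snd e)) \<union> path_image g"
      using g(2) by (simp add: path_image_join)
    also have "\<dots> = closed_segment (point u) (point (snd e)) \<union> (\<Union>e \<in> set p. edge_segment e)"
      using g(4) by auto
    finally show "path_image (linepath (point u) (point (snd e)) +++ g) =
        insert (point u) (\<Union>e \<in> set (e # p). edge_segment e)"
      by (simp add: eq)
  qed (use g in auto)
qed

text \<open>Transport to \<open>real^2\<close>, the type in which \<open>fashoda\<close> is
  stated.\<close>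

definition to_vec :: "real \<times> real \<Rightarrow> real^2" where
  "to_vec z = vector [fst z, snd z]"

lemma to_vec_nth [simp]: "to_vec z $ 1 = fst z" "to_vec z $ 2 = snd z"
  by (simp_all add: to_vec_def)

lemma linear_to_vec: "linear to_vec"
  by (rule linearI) (simp_all add: vec_eq_iff forall_2)

lemma to_vec_eq_iff [simp]: "to_vec y = to_vec z \<longleftrightarrow> y = z"
  by (auto simp: vec_eq_iff forall_2 prod_eq_iff)

lemma fashoda_prod:
  fixes a b :: "real \<times> real"
  assumes "path f" "path g" "path_image f \<subseteq> cbox a b" "path_image g \<subseteq> cbox a b"
    "fst (pathstart f) = fst a" "fst (pathfinish f) = fst b"
    "snd (pathstart g) = snd b" "snd (pathfinish g) = snd a"
  obtains z where "z \<in> path_image f" "z \<in> path_image g"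
proof -
  have cont: "continuous_on S to_vec" for S
    using linear_to_vec by (simp add: linear_continuous_on linear_conv_bounded_linear)
  have box: "to_vec z \<in> cbox (to_vec a) (to_vec b)" if "z \<in> cbox a b" for z
    using that by (cases z, cases a, cases b) (auto simp: mem_box_cart forall_2 cbox_Pair_eq)
  \<comment> \<open>\<open>g\<close> runs from top to bottom, whereas \<open>fashoda\<close> asks
    for the opposite direction.\<close>
  obtain z where "z \<in> path_image (to_vec \<circ> f)" "z \<in> path_image (to_vec \<circ> reversepath g)"
  proof (rule fashoda)
    show "path (to_vec \<circ> f)" "path (to_vec \<circ> reversepath g)"
      using assms cont by (auto intro: path_continuous_image)
    show "path_image (to_vec \<circ> f) \<subseteq> cbox (to_vec a) (to_vec b)"
      "path_image (to_vec \<circ> reversepath g) \<subseteq> cbox (to_vec a) (to_vec b)"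
      using assms(3,4) box by (auto simp: path_image_compose)
  qed (use assms in \<open>auto simp: pathstart_compose pathfinish_compose\<close>)
  then show thesis
    using that by (auto simp: path_image_compose)
qed

lemma edge_segment_subset_box:
  assumes "u \<in> grid l l'" "v \<in> grid l l'"
  shows "edge_segment (u, v) \<subseteq> cbox (1, 1) (real l, real l')"
proof -
  have "point w \<in> cbox (1, 1) (real l, real l')" if "w \<in> grid l l'" for w
    using that by (auto simp: point_def grid_def cbox_Pair_eq)
  then have "closed_segment (point u) (point v) \<subseteq> cbox (1, 1) (real l, real l')"
    using assms by (intro closed_segment_subset convex_box) auto
  then show ?thesis by (auto simp: edge_segment_def)
qed

text \<open>By convexity, edges between grid cells stay in the box spanned by the grid, and the four
  ends lie on its four sides, as Fashoda's theorem requires.\<close>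

lemma walks_meet:
  assumes p: "pcas n p s" "set p \<subseteq> grid l l' \<times> grid l l'"
    and q: "pcas w q e" "set q \<subseteq> grid l l' \<times> grid l l'"
    and ends: "n \<in> north_edge l l'" "s \<in> south_edge l l'" "w \<in> west_edge l l'" "e \<in> east_edge l l'"
  obtains z where "z \<in> insert (point n) (\<Union>a \<in> set p. edge_segment a)"
    "z \<in> insert (point w) (\<Union>b \<in> set q. edge_segment b)"
proof -
  have box: "insert (point u) (\<Union>a \<in> set r. edge_segment a) \<subseteq> cbox (1, 1) (real l, real l')"
    if "u \<in> grid l l'" "set r \<subseteq> grid l l' \<times> grid l l'" for u r
  proof -
    have "point u \<in> cbox (1, 1) (real l, real l')"
      using that(1) by (auto simp: point_def grid_def cbox_Pair_eq)
    moreover have "edge_segment a \<subseteq> cbox (1, 1) (real l, real l')" if "a \<in> set r" for a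
    proof -
      have "a \<in> grid l l' \<times> grid l l'"
        using that \<open>set r \<subseteq> grid l l' \<times> grid l l'\<close> by blast
      then show ?thesis
        using edge_segment_subset_box[of "fst a" l l' "snd a"] by (simp add: mem_Times_iff)
    qed
    ultimately show ?thesis by blast
  qed
  obtain g where g: "path g" "pathstart g = point n" "pathfinish g = point s"
    "path_image g = insert (point n) (\<Union>a \<in> set p. edge_segment a)"
    using p(1) by (rule polyline_path)
  obtain f where f: "path f" "pathstart f = point w" "pathfinish f = point e"
    "path_image f = insert (point w) (\<Union>b \<in> set q. edge_segment b)"
    using q(1) by (rule polyline_path)
  have "n \<in> grid l l'" "w \<in> grid l l'"
    using ends by (auto simp: north_edge_def west_edge_def)
  then have box_f: "path_image f \<subseteq> cbox (1, 1) (real l, real l')"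
    and box_g: "path_image g \<subseteq> cbox (1, 1) (real l, real l')"
    unfolding f g using box p(2) q(2) by blast+
  obtain z where "z \<in> path_image f" "z \<in> path_image g"
  proof (rule fashoda_prod[OF f(1) g(1) box_f box_g])
  qed (use ends in \<open>auto simp: f g point_def north_edge_def south_edge_def west_edge_def east_edge_def\<close>)
  then show thesis
    using that f g by blast
qed

section \<open>Two avalanches on one configuration\<close>

text \<open>With \<open>S\<close> all toppled cells these are the arcs of a toppling graph; with
  \<open>S\<close> the cells toppling in one avalanche only, those of the subgraph in which walks
  are built.\<close>

definition increasing_arcs :: "cell set \<Rightarrow> cell set \<Rightarrow> (cell \<Rightarrow> nat) \<Rightarrow> (cell \<times> cell) set" where
  "increasing_arcs N S \<tau> = {(u, v). u \<in> S \<and> v \<in> S \<and> v - u \<in> N \<and> \<tau> u < \<tau> v}"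

lemma increasing_arcs_mono: "S \<subseteq> S' \<Longrightarrow> increasing_arcs N S \<tau> \<subseteq> increasing_arcs N S' \<tau>"
  by (auto simp: increasing_arcs_def)

lemma increasing_arcs_subset: "increasing_arcs N S \<tau> \<subseteq> S \<times> S"
  by (auto simp: increasing_arcs_def)

lemma pcas_append_Cons: "pcas u (p @ e # q) v \<longleftrightarrow> pcas u p (fst e) \<and> pcas (snd e) q v"
  by (induction p arbitrary: u) auto

text \<open>Toppling times strictly increase along such a walk.\<close>

lemma pcas_increasing_arcs:
  assumes "pcas u p v" "set p \<subseteq> increasing_arcs N S \<tau>"
  shows distinct_pawalk_verts: "distinct (pawalk_verts u p)"
    and start_before_arcs: "a \<in> set p \<Longrightarrow> \<tau> u \<le> \<tau> (fst a)"
proof -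
  have "distinct (pawalk_verts u p) \<and> (\<forall>x \<in> set (pawalk_verts u p). \<tau> u \<le> \<tau> x) \<and>
      (\<forall>a \<in> set p. \<tau> u \<le> \<tau> (fst a))"
    using assms
  proof (induction p arbitrary: u)
    case (Cons e p)
    then have "fst e = u" "pcas (snd e) p v" "\<tau> u < \<tau> (snd e)" "set p \<subseteq> increasing_arcs N S \<tau>"
      by (auto simp: increasing_arcs_def)
    then show ?case
      using Cons.IH[of "snd e"] by fastforce
  qed simp
  then show "distinct (pawalk_verts u p)" "a \<in> set p \<Longrightarrow> \<tau> u \<le> \<tau> (fst a)"
    by auto
qed

section \<open>Comparison of two avalanches\<close>

context avalanche
begin

lemma finite_T: "finite T"
  using T_subset finite_V finite_subset by blast

text \<open>A cell that topples first has received no grain from other cells; being stable before,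
  it needs the added grain and so is \<open>x\<close>.\<close>

lemma start:
  assumes "T \<noteq> {}"
  shows "x \<in> T" "card N \<le> c x + 1"
proof -
  obtain u where u: "u \<in> T" "\<And>v. v \<in> T \<Longrightarrow> \<tau> u \<le> \<tau> v"
    using assms ex_has_least_nat[of "\<lambda>u. u \<in> T" _ \<tau>] by blast
  then have "in_cells N {v \<in> T. \<tau> v < \<tau> u} u = {}"
    by (force simp: in_cells_def)
  then have "card N \<le> c u + of_bool (u = x)"
    using toppled[OF u(1)] by simp
  moreover have "c u < card N"
    using u(1) T_subset stable_V by blast
  ultimately show "x \<in> T" "card N \<le> c x + 1"
    using u(1) by (cases "u = x"; simp)+
qed

text \<open>Induction on toppling times: the senders that made \<open>u\<close> topple also topple
  in the other avalanche, so \<open>u\<close> receives at least as many grains there. The only grain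
  that may be missing is the one added at \<open>x\<close>, and \<open>x\<close> is in
  \<open>T'\<close> anyway.\<close>

lemma avalanche_subset:
  assumes "avalanche N V c x' T' \<tau>'" "x \<in> T'"
  shows "T \<subseteq> T'"
proof
  interpret other: avalanche N V c x' T' \<tau>' by fact
  fix u assume "u \<in> T"
  then show "u \<in> T'"
  proof (induction "\<tau> u" arbitrary: u rule: less_induct)
    case less
    show ?case
    proof (rule ccontr)
      assume "u \<notin> T'"
      then have "u \<noteq> x" using assms(2) by auto
      have "in_cells N {v \<in> T. \<tau> v < \<tau> u} u \<subseteq> in_cells N T' u"
        using less.hyps by (auto simp: in_cells_def)
      then have "card (in_cells N {v \<in> T. \<tau> v < \<tau> u} u) \<le> card (in_cells N T' u)"
        by (intro card_mono finite_in_cells other.finite_T)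
      moreover have "card (in_cells N T' u) + c u < card N"
        using other.untoppled[of u] \<open>u \<notin> T'\<close> less.prems T_subset by auto
      ultimately show False
        using toppled[OF less.prems] \<open>u \<noteq> x\<close> by simp
    qed
  qed
qed

text \<open>\<open>x\<close> is one grain short of toppling, so a single grain from
  \<open>T'\<close> would make it topple in the other avalanche.\<close>

lemma no_in_cells_at_start:
  assumes "avalanche N V c x' T' \<tau>'" "T \<noteq> {}" "x \<notin> T'"
  shows "in_cells N T' x = {}"
proof -
  interpret other: avalanche N V c x' T' \<tau>' by fact
  have "c x + card (in_cells N T' x) < card N"
    using other.untoppled[of x] assms(3) start(1)[OF assms(2)] T_subset by auto
  then have "card (in_cells N T' x) = 0"
    using start(2)[OF assms(2)] by simp
  then show ?thesis
    using finite_in_cells[OF other.finite_T] by simp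
qed

text \<open>
  Cells toppling in both avalanches send \<open>u\<close> as many grains in either one, so \<open>u\<close> owes its
  toppling to the cells that topple in one avalanche only.
\<close>

lemma card_in_cells_less_preds:
  assumes "avalanche N V c x' T' \<tau>'" "u \<in> T - T'" "u \<noteq> x"
  shows "card (in_cells N (T' - T) u) < card (in_cells N {v \<in> T - T'. \<tau> v < \<tau> u} u)"
proof -
  interpret other: avalanche N V c x' T' \<tau>' by fact
  note fin = finite_in_cells finite_Diff finite_Int finite_T other.finite_T
  have "in_cells N {v \<in> T. \<tau> v < \<tau> u} u \<subseteq>
      in_cells N {v \<in> T - T'. \<tau> v < \<tau> u} u \<union> in_cells N (T \<inter> T') u"
    by (auto simp: in_cells_def)
  then have "card (in_cells N {v \<in> T. \<tau> v < \<tau> u} u) \<le>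
      card (in_cells N {v \<in> T - T'. \<tau> v < \<tau> u} u \<union> in_cells N (T \<inter> T') u)"
    using fin by (intro card_mono) auto
  also have "\<dots> \<le> card (in_cells N {v \<in> T - T'. \<tau> v < \<tau> u} u) + card (in_cells N (T \<inter> T') u)"
    by (rule card_Un_le)
  finally have own: "card (in_cells N {v \<in> T. \<tau> v < \<tau> u} u) \<le>
      card (in_cells N {v \<in> T - T'. \<tau> v < \<tau> u} u) + card (in_cells N (T \<inter> T') u)" .
  have "in_cells N T' u = in_cells N (T' - T) u \<union> in_cells N (T \<inter> T') u"
    by (auto simp: in_cells_def)
  moreover have "in_cells N (T' - T) u \<inter> in_cells N (T \<inter> T') u = {}"
    by (auto simp: in_cells_def)
  ultimately have "card (in_cells N T' u) = card (in_cells N (T' - T) u) + card (in_cells N (T \<inter> T') u)"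
    using fin by (simp add: card_Un_disjoint)
  then show ?thesis
    using own toppled[of u] other.untoppled[of u] assms(2,3) T_subset by auto
qed

text \<open>The walk is built backwards: a cell other than \<open>x\<close> has strictly more
  predecessors in \<open>T - T'\<close> than some natural number, hence at least one. The bound on
  times serves the later descent.\<close>

lemma exists_walk_avoiding:
  assumes other: "avalanche N V c x' T' \<tau>'" and u: "u \<in> T - T'" and x: "x \<notin> T'"
  obtains p where "pcas x p u" "set p \<subseteq> increasing_arcs N (T - T') \<tau>"
    "\<And>a. a \<in> set p \<Longrightarrow> \<tau> (snd a) \<le> \<tau> u"
  using u
proof (induction "\<tau> u" arbitrary: u thesis rule: less_induct)
  case less
  show ?case
  proof (cases "u = x")
    case True
    then show ?thesis by (intro less.prems(1)[of "[]"]) auto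
  next
    case False
    then have "card (in_cells N {v \<in> T - T'. \<tau> v < \<tau> u} u) \<noteq> 0"
      using card_in_cells_less_preds[OF other less.prems(2)] by simp
    then have "in_cells N {v \<in> T - T'. \<tau> v < \<tau> u} u \<noteq> {}"
      by (metis card.empty)
    then obtain v where v: "v \<in> T - T'" "\<tau> v < \<tau> u" "u - v \<in> N"
      by (auto simp: in_cells_def)
    obtain p where p: "pcas x p v" "set p \<subseteq> increasing_arcs N (T - T') \<tau>"
      "\<And>a. a \<in> set p \<Longrightarrow> \<tau> (snd a) \<le> \<tau> v"
      using less.hyps[OF v(2) _ v(1)] by metis
    show ?thesis
    proof (rule less.prems(1))
      show "pcas x (p @ [(v, u)]) u" using p(1) by (auto simp: pcas_append_Cons)
      show "set (p @ [(v, u)]) \<subseteq> increasing_arcs N (T - T') \<tau>"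
        using p(2) v less.prems(2) by (auto simp: increasing_arcs_def)
      show "\<tau> (snd a) \<le> \<tau> u" if "a \<in> set (p @ [(v, u)])" for a
        using that p(3)[of a] v(2) by auto
    qed
  qed
qed

end

section \<open>The North and West avalanches of a crossing gate\<close>

locale crossing_avalanches =
  north: avalanche N_i "grid l l'" c n Tn \<tau>n + west: avalanche N_i "grid l l'" c w Tw \<tau>w
  for l l' :: nat and c :: config and n w :: cell and Tn Tw :: "cell set" and \<tau>n \<tau>w :: "cell \<Rightarrow> nat" +
  fixes s e :: cell
  assumes n: "n \<in> north_edge l l'" and w: "w \<in> west_edge l l'"
    and s: "s \<in> south_edge l l'" "s \<in> Tn" "s \<notin> Tw"
    and e: "e \<in> east_edge l l'" "e \<in> Tw" "e \<notin> Tn"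
begin

abbreviation "A \<equiv> Tn - Tw"
abbreviation "B \<equiv> Tw - Tn"
abbreviation "EA \<equiv> increasing_arcs N_i A \<tau>n"
abbreviation "EB \<equiv> increasing_arcs N_i B \<tau>w"
abbreviation "EW \<equiv> increasing_arcs N_i Tw \<tau>w"

text \<open>Pairs are counted against all arcs \<open>EW\<close> of the West avalanche, which
  include those in \<open>EB\<close>.\<close>

definition crossings :: "(cell \<times> cell) list \<Rightarrow> ((cell \<times> cell) \<times> (cell \<times> cell)) set" where
  "crossings p = {(a, b). a \<in> set p \<and> b \<in> EW \<and> edges_cross a b}"

lemma finite_crossings: "finite (crossings p)"
proof (rule finite_subset)
  show "crossings p \<subseteq> set p \<times> (Tw \<times> Tw)"
    using increasing_arcs_subset[of N_i Tw \<tau>w] by (auto simp: crossings_def)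
qed (intro finite_cartesian_product finite_set west.finite_T)

lemma start_cells: "n \<in> A" "w \<in> B"
proof -
  have "n \<in> Tn" "w \<in> Tw"
    using north.start(1) west.start(1) s e by auto
  moreover have "n \<notin> Tw"
    using north.avalanche_subset[OF west.avalanche_axioms] s by auto
  moreover have "w \<notin> Tn"
    using west.avalanche_subset[OF north.avalanche_axioms] e by auto
  ultimately show "n \<in> A" "w \<in> B" by auto
qed

lemma no_in_cells:
  "v \<in> Tw \<Longrightarrow> n - v \<notin> N_i" "v \<in> Tn \<Longrightarrow> w - v \<notin> N_i"
proof -
  have "in_cells N_i Tw n = {}" "in_cells N_i Tn w = {}"
    using north.no_in_cells_at_start[OF west.avalanche_axioms]
      west.no_in_cells_at_start[OF north.avalanche_axioms] start_cells by blast+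
  then show "v \<in> Tw \<Longrightarrow> n - v \<notin> N_i" "v \<in> Tn \<Longrightarrow> w - v \<notin> N_i"
    unfolding in_cells_def by blast+
qed

text \<open>A sender in \<open>B\<close> makes the count at least one, and the predecessors in
  \<open>A\<close> strictly exceed it. \<open>u\<close> is not the start cell, since no cell of
  \<open>Tw\<close> can send \<open>n\<close> a grain.\<close>

lemma two_preds_A:
  assumes "u \<in> A" "v \<in> B" "u - v \<in> N_i"
  obtains x y where "x \<noteq> y" "(x, u) \<in> EA" "(y, u) \<in> EA"
proof -
  let ?P = "in_cells N_i {v \<in> A. \<tau>n v < \<tau>n u} u"
  have "u \<noteq> n" using assms no_in_cells(1)[of v] by auto
  moreover have "v \<in> in_cells N_i B u"
    using assms by (simp add: in_cells_def)
  then have "card (in_cells N_i B u) \<noteq> 0"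
    using finite_in_cells[of B N_i u] west.finite_T card_eq_0_iff by blast
  ultimately have "\<not> card ?P \<le> Suc 0"
    using north.card_in_cells_less_preds[OF west.avalanche_axioms assms(1)] by simp
  moreover have "finite ?P"
    using north.finite_T by (intro finite_in_cells) auto
  ultimately obtain x y where "x \<in> ?P" "y \<in> ?P" "x \<noteq> y"
    by (auto simp: card_le_Suc0_iff_eq)
  then show thesis
    using that[of x y] assms(1) by (auto simp: in_cells_def increasing_arcs_def)
qed

lemma two_preds_B:
  assumes "u \<in> B" "v \<in> A" "u - v \<in> N_i"
  obtains x y where "x \<noteq> y" "(x, u) \<in> EB" "(y, u) \<in> EB"
proof -
  let ?P = "in_cells N_i {v \<in> B. \<tau>w v < \<tau>w u} u"
  have "u \<noteq> w" using assms no_in_cells(2)[of v] by auto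
  moreover have "v \<in> in_cells N_i A u"
    using assms by (simp add: in_cells_def)
  then have "card (in_cells N_i A u) \<noteq> 0"
    using finite_in_cells[of A N_i u] north.finite_T card_eq_0_iff by blast
  ultimately have "\<not> card ?P \<le> Suc 0"
    using west.card_in_cells_less_preds[OF north.avalanche_axioms assms(1)] by simp
  moreover have "finite ?P"
    using west.finite_T by (intro finite_in_cells) auto
  ultimately obtain x y where "x \<in> ?P" "y \<in> ?P" "x \<noteq> y"
    by (auto simp: card_le_Suc0_iff_eq)
  then show thesis
    using that[of x y] assms(1) by (auto simp: in_cells_def increasing_arcs_def)
qed

lemma pred_B:
  assumes "u \<in> B" "u \<noteq> w"
  obtains v where "(v, u) \<in> EB"
proof -
  have "card (in_cells N_i {v \<in> B. \<tau>w v < \<tau>w u} u) \<noteq> 0"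
    using west.card_in_cells_less_preds[OF north.avalanche_axioms assms] by simp
  then have "in_cells N_i {v \<in> B. \<tau>w v < \<tau>w u} u \<noteq> {}"
    by (metis card.empty)
  then show thesis
    using that assms(1) by (auto simp: in_cells_def increasing_arcs_def)
qed

text \<open>The curves meet, but edges omit their tails, so the start points must be ruled out. If
  \<open>n\<close> lay on an edge of \<open>EB\<close>, it would be the head, against disjointness,
  or the midpoint of an edge of direction \<open>(0, - 2)\<close>, whose tail could send
  \<open>n\<close> a grain. The same holds for \<open>w\<close> and \<open>EA\<close>.\<close>

lemma walks_cross:
  assumes p: "pcas n p s" "set p \<subseteq> EA" and q: "pcas w q e" "set q \<subseteq> EB"
  obtains a b where "a \<in> set p" "b \<in> set q" "edges_cross a b"
proof -
  have grid: "set p \<subseteq> grid l l' \<times> grid l l'" "set q \<subseteq> grid l l' \<times> grid l l'"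
    using p(2) q(2) increasing_arcs_subset north.T_subset west.T_subset by blast+
  have N_i: "(0, - 1) \<in> N_i" by (simp add: N_i_iff)
  obtain z where z: "z \<in> insert (point n) (\<Union>a \<in> set p. edge_segment a)"
    "z \<in> insert (point w) (\<Union>b \<in> set q. edge_segment b)"
    using walks_meet[OF p(1) grid(1) q(1) grid(2) n s(1) w e(1)] by blast
  have "z \<noteq> point n"
  proof
    assume "z = point n"
    then obtain u v where uv: "(u, v) \<in> EB" "point n \<in> edge_segment (u, v)"
      using z(2) q(2) start_cells by fastforce
    then have "n = v \<or> n = u - (0, 1)"
      using point_in_edge_segment[of v u n] by (auto simp: increasing_arcs_def)
    then show False
      using uv(1) start_cells no_in_cells(1)[of u] N_i by (auto simp: increasing_arcs_def)
  qed
  moreover have "z \<noteq> point w"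
  proof
    assume "z = point w"
    then obtain u v where uv: "(u, v) \<in> EA" "point w \<in> edge_segment (u, v)"
      using z(1) p(2) start_cells by fastforce
    then have "w = v \<or> w = u - (0, 1)"
      using point_in_edge_segment[of v u w] by (auto simp: increasing_arcs_def)
    then show False
      using uv(1) start_cells no_in_cells(2)[of u] N_i by (auto simp: increasing_arcs_def)
  qed
  ultimately show thesis
    using z that unfolding edges_cross_def by blast
qed

lemma crossings_unique:
  assumes "card (crossings p) < 2" "r \<in> crossings p" "r' \<in> crossings p"
  shows "r = r'"
  using assms finite_crossings[of p] card_le_Suc0_iff_eq[of "crossings p"] by auto

text \<open>
  The earliest cell \<open>y\<close> of \<open>B\<close> that cannot be reached from \<open>w\<close> without
  crossing \<open>p\<close> is entered only by edges crossing \<open>p\<close>. Hence it has a single predecessor in \<open>B\<close> and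
  so no cell of \<open>A\<close> sends it a grain, which excludes all but one way of crossing.
\<close>

lemma unique_crossing:
  assumes p: "pcas n p s" "set p \<subseteq> EA" and card: "card (crossings p) < 2"
  obtains u b where "((u, u + (1, - 1)), b) \<in> crossings p" "u + (1, 0) \<in> B"
proof -
  define R where "R = {v. \<exists>q. pcas w q v \<and> set q \<subseteq> EB \<and> (\<forall>a \<in> set p. \<forall>b \<in> set q. \<not> edges_cross a b)}"
  have "w \<in> R"
    unfolding R_def by (auto intro!: exI[of _ "[]"])
  have "e \<notin> R"
  proof
    assume "e \<in> R"
    then obtain q where q: "pcas w q e" "set q \<subseteq> EB" "\<forall>a \<in> set p. \<forall>b \<in> set q. \<not> edges_cross a b"
      by (auto simp: R_def)
    show False
      using walks_cross[OF p q(1,2)] q(3) by blast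
  qed
  then obtain y where y: "y \<in> B - R" and y_min: "\<And>v. v \<in> B - R \<Longrightarrow> \<tau>w y \<le> \<tau>w v"
  proof -
    have "e \<in> B - R" using e \<open>e \<notin> R\<close> by simp
    then show thesis
      using ex_has_least_nat[of "\<lambda>u. u \<in> B - R" e \<tau>w] that by metis
  qed
  have EB_EW: "EB \<subseteq> EW" by (intro increasing_arcs_mono) auto
  \<comment> \<open>By minimality of \<open>y\<close> its predecessor \<open>x\<close>, which
    topples earlier, lies in \<open>R\<close>; if no edge of \<open>p\<close> crossed
    \<open>(x, y)\<close>, then \<open>y\<close> would lie in \<open>R\<close> too.\<close>
  have enter: "\<exists>a \<in> set p. edges_cross a (x, y)" if x: "(x, y) \<in> EB" for x
  proof (rule ccontr)
    assume no: "\<not> (\<exists>a \<in> set p. edges_cross a (x, y))"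
    have "x \<in> R"
    proof (rule ccontr)
      assume "x \<notin> R"
      then have "\<tau>w y \<le> \<tau>w x"
        using x by (intro y_min) (auto simp: increasing_arcs_def)
      then show False
        using x by (simp add: increasing_arcs_def)
    qed
    then obtain q where q: "pcas w q x" "set q \<subseteq> EB" "\<forall>a \<in> set p. \<forall>b \<in> set q. \<not> edges_cross a b"
      by (auto simp: R_def)
    have "y \<in> R"
      unfolding R_def using q x no by (auto simp: pcas_append_Cons intro!: exI[of _ "q @ [(x, y)]"])
    then show False using y by simp
  qed
  have no_A: "y - v \<notin> N_i" if v: "v \<in> A" for v
  proof
    assume "y - v \<in> N_i"
    then obtain x x' where "x \<noteq> x'" "(x, y) \<in> EB" "(x', y) \<in> EB"
      using two_preds_B[OF DiffD1[OF y] v] by blast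
    moreover from this obtain a a' where "(a, (x, y)) \<in> crossings p" "(a', (x', y)) \<in> crossings p"
      using enter EB_EW unfolding crossings_def by blast
    ultimately show False
      using crossings_unique[OF card] by blast
  qed
  have "y \<noteq> w" using y \<open>w \<in> R\<close> by auto
  then obtain x where x: "(x, y) \<in> EB"
    using pred_B y by blast
  obtain u v where uv: "(u, v) \<in> set p" "edges_cross (u, v) (x, y)"
    using enter[OF x] by auto
  then have cr: "((u, v), (x, y)) \<in> crossings p"
    using x EB_EW by (auto simp: crossings_def)
  have EA: "u \<in> A" "v \<in> A" "v - u \<in> N_i"
    using uv(1) p(2) by (auto simp: increasing_arcs_def)
  have EB: "x \<in> B" "y \<in> B" "y - x \<in> N_i"
    using x by (auto simp: increasing_arcs_def)
  have "{u, v} \<inter> {x, y} = {}"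
    using EA EB by auto
  \<comment> \<open>Case 1 is the desired crossing unless \<open>y\<close> lies just below
    \<open>u\<close>; in cases 2 and 4 some cell of \<open>A\<close> lies just above
    \<open>y\<close>. Both situations contradict \<open>no_A\<close>, because
    \<open>(0, - 1)\<close> is in \<open>N_i\<close>.\<close>
  from uv(2) EA(3) EB(3) this show thesis
  proof (cases rule: edges_cross_cases)
    case 1
    then show ?thesis
      using that[of u "(x, y)"] cr EB(2) no_A[OF EA(1)] by (auto simp: N_i_iff)
  next
    case 2
    then have "x + (1, 0) \<in> A" "y - (x + (1, 0)) = (0, - 1)"
      using EA by auto
    then show ?thesis
      using no_A by (auto simp: N_i_iff)
  next
    case 3
    \<comment> \<open>\<open>u\<close> can send a grain to the midpoint \<open>m\<close>, so
      \<open>m\<close> has two predecessors in \<open>B\<close>. Both edges into \<open>m\<close>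
      meet \<open>(u, v)\<close> at \<open>m\<close>, which makes two crossing pairs.\<close>
    define m where "m = u - (0, 1)"
    have "m \<in> B" using 3(2) EB by (auto simp: m_def)
    moreover have "m - u \<in> N_i" by (simp add: m_def N_i_iff)
    ultimately obtain k k' where k: "k \<noteq> k'" "(k, m) \<in> EB" "(k', m) \<in> EB"
      using two_preds_B EA(1) by blast
    have "((u, v), (j, m)) \<in> crossings p" if "(j, m) \<in> EB" for j
    proof -
      have "j \<noteq> m" using that by (auto simp: increasing_arcs_def)
      then have "edges_cross (u, v) (j, m)"
        using head_in_edge_segment[of j m] mid_in_edge_segment[of u] 3(1)
        by (auto simp: edges_cross_def m_def)
      then show ?thesis
        using that uv(1) EB_EW by (auto simp: crossings_def)
    qed
    then show ?thesis
      using crossings_unique[OF card] k by blast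
  next
    case 4
    then have "x - (0, 1) \<in> A" "y - (x - (0, 1)) = (0, - 1)"
      using EA by auto
    then show ?thesis
      using no_A by (auto simp: N_i_iff)
  qed
qed

lemma no_crossing_if_all_unique:
  assumes all: "\<And>p. pcas n p s \<Longrightarrow> set p \<subseteq> EA \<Longrightarrow> card (crossings p) < 2"
    and p: "pcas n p s" "set p \<subseteq> EA"
    and cr: "((u, u + (1, - 1)), b) \<in> crossings p" and u: "u + (1, 0) \<in> B"
  shows False
  using p cr u
proof (induction "\<tau>n (u + (1, - 1))" arbitrary: p u b rule: less_induct)
  case less
  define v where "v = u + (1, - 1)"
  have uv: "(u, v) \<in> set p" "(u, v) \<in> EA"
    using less.prems by (auto simp: crossings_def v_def)
  have "v - (u + (1, 0)) \<in> N_i" by (simp add: v_def N_i_iff)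
  moreover have "v \<in> A" using uv(2) by (simp add: increasing_arcs_def)
  ultimately obtain z where z: "z \<noteq> u" "(z, v) \<in> EA"
    using two_preds_A[of v "u + (1, 0)"] less.prems(4) by metis
  obtain p1 p2 where p12: "p = p1 @ (u, v) # p2"
    using split_list[OF uv(1)] by blast
  then have p2: "pcas v p2 s" "set p2 \<subseteq> EA"
    using less.prems(1,2) by (auto simp: pcas_append_Cons)
  have "z \<in> A" "\<tau>n z < \<tau>n v" using z(2) by (auto simp: increasing_arcs_def)
  then obtain p0 where p0: "pcas n p0 z" "set p0 \<subseteq> EA" "\<And>a. a \<in> set p0 \<Longrightarrow> \<tau>n (snd a) \<le> \<tau>n z"
    using north.exists_walk_avoiding[OF west.avalanche_axioms] start_cells by blast
  let ?p = "p0 @ (z, v) # p2"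
  have p': "pcas n ?p s" "set ?p \<subseteq> EA"
    using p0 p2 z(2) by (auto simp: pcas_append_Cons)
  obtain u' b' where u': "((u', u' + (1, - 1)), b') \<in> crossings ?p" "u' + (1, 0) \<in> B"
    using unique_crossing[OF p' all[OF p']] by blast
  \<comment> \<open>Before \<open>z\<close> the head of the new crossing edge topples earlier than
    \<open>v\<close>, and induction applies. The edge \<open>(z, v)\<close> would force
    \<open>z = u\<close>. An edge of the common tail \<open>p2\<close> also crosses on
    \<open>p\<close>, so it is \<open>(u, v)\<close>, but \<open>u\<close> topples before
    \<open>v\<close>, where \<open>p2\<close> starts.\<close>
  then consider "(u', u' + (1, - 1)) \<in> set p0" | "(u', u' + (1, - 1)) = (z, v)"
    | "(u', u' + (1, - 1)) \<in> set p2"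
    by (auto simp: crossings_def)
  then show False
  proof cases
    case 1
    then have "\<tau>n (u' + (1, - 1)) < \<tau>n (u + (1, - 1))"
      using p0(3)[OF 1] \<open>\<tau>n z < \<tau>n v\<close> by (simp add: v_def)
    then show ?thesis
      using less.hyps p' u' by blast
  next
    case 2
    then have "u' = z" "u' + (1, - 1) = u + (1, - 1)" by (auto simp: v_def)
    then show ?thesis using z(1) by simp
  next
    case 3
    then have cr': "((u', u' + (1, - 1)), b') \<in> crossings p"
      using u' by (auto simp: crossings_def p12)
    have "u' = u"
      using crossings_unique[OF all[OF less.prems(1,2)] cr' less.prems(3)] by simp
    then have "\<tau>n v \<le> \<tau>n u"
      using start_before_arcs[OF p2 3] by simp
    then show ?thesis using uv(2) by (simp add: increasing_arcs_def)
  qed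
qed

lemma exists_walk_crossing_twice:
  obtains p where "pcas n p s" "set p \<subseteq> EA" "2 \<le> card (crossings p)"
proof -
  obtain p where p: "pcas n p s" "set p \<subseteq> EA"
  proof (rule north.exists_walk_avoiding[OF west.avalanche_axioms])
    show "s \<in> A" "n \<notin> Tw" using s start_cells by auto
  qed
  have "\<exists>p. pcas n p s \<and> set p \<subseteq> EA \<and> 2 \<le> card (crossings p)"
  proof (rule ccontr)
    assume "\<not> ?thesis"
    then have all: "card (crossings p) < 2" if "pcas n p s" "set p \<subseteq> EA" for p
      using that by (meson not_le)
    show False
      by (rule unique_crossing[OF p all[OF p]]) (rule no_crossing_if_all_unique[OF all p])
  qed
  then show thesis using that by blast
qed

end

theorem lemma1:
  fixes l l' :: nat and c :: config and n s w e :: cell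
  assumes "l \<ge> 1" and "l' \<ge> 1"
    and "crossing_gate N_i l l' c n s w e"
  shows "\<exists>p. pre_digraph.apath (with_proj (toppling_graph N_i l l' c n)) n p s \<and>
             card {(a, b). a \<in> set p \<and> b \<in> parcs (toppling_graph N_i l l' c w) \<and>
                           edges_cross a b} \<ge> 2"
proof -
  let ?Tn = "{u. topples N_i l l' (add_grain c n) u}" and ?\<tau>n = "toppling_time N_i l l' (add_grain c n)"
  let ?Tw = "{u. topples N_i l l' (add_grain c w) u}" and ?\<tau>w = "toppling_time N_i l l' (add_grain c w)"
  note gate = assms(3)[unfolded crossing_gate_def]
  have st: "stable N_i l l' c" and n: "n \<in> north_edge l l'" and w: "w \<in> west_edge l l'"
    and s: "s \<in> south_edge l l'" "s \<in> ?Tn" "s \<notin> ?Tw" and e: "e \<in> east_edge l l'" "e \<in> ?Tw" "e \<notin> ?Tn"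
    using gate by auto
  have fin: "finite N_i" by (simp add: N_i_def)
  have n_grid: "n \<in> grid l l'" and w_grid: "w \<in> grid l l'"
    using n w by (auto simp: north_edge_def west_edge_def)
  \<comment> \<open>The absent senders: the cell just above \<open>n\<close>, and for
    \<open>w\<close> the cell \<open>w - (1, 1)\<close> in column 0.\<close>
  have n_out: "(0, - 1) \<in> N_i" "n - (0, - 1) \<notin> grid l l'"
    using n by (auto simp: N_i_iff north_edge_def grid_def)
  have w_out: "(1, 1) \<in> N_i" "w - (1, 1) \<notin> grid l l'"
    using w by (auto simp: N_i_iff west_edge_def grid_def)
  interpret n: border_grain N_i l l' c n "(0, - 1)"
    using fin st n_grid n_out by unfold_locales
  interpret w: border_grain N_i l l' c w "(1, 1)"
    using fin st w_grid w_out by unfold_locales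
  interpret crossing_avalanches l l' c n w ?Tn ?Tw ?\<tau>n ?\<tau>w s e
    using n.avalanche_topples w.avalanche_topples n w s e
    by (intro crossing_avalanches.intro crossing_avalanches_axioms.intro) auto
  have arcs_n: "parcs (toppling_graph N_i l l' c n) = increasing_arcs N_i ?Tn ?\<tau>n"
    using n.parcs_toppling_graph by (simp add: increasing_arcs_def)
  have arcs_w: "parcs (toppling_graph N_i l l' c w) = increasing_arcs N_i ?Tw ?\<tau>w"
    using w.parcs_toppling_graph by (simp add: increasing_arcs_def)
  obtain p where p: "pcas n p s" "set p \<subseteq> EA" "2 \<le> card (crossings p)"
    by (rule exists_walk_crossing_twice)
  have "EA \<subseteq> increasing_arcs N_i ?Tn ?\<tau>n"
    by (intro increasing_arcs_mono) auto
  then have "set p \<subseteq> parcs (toppling_graph N_i l l' c n)"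
    using p(2) arcs_n by blast
  moreover have "n \<in> pverts (toppling_graph N_i l l' c n)"
    using start_cells(1) by (simp add: toppling_graph_def)
  \<comment> \<open>The walk is a path because toppling times increase along it.\<close>
  ultimately have "pre_digraph.apath (with_proj (toppling_graph N_i l l' c n)) n p s"
    using p(1) distinct_pawalk_verts[OF p(1,2)]
    by (simp add: pre_digraph.apath_def pre_digraph.awalk_def cas_with_proj_eq awalk_verts_with_proj_eq)
  moreover have "card {(a, b). a \<in> set p \<and> b \<in> parcs (toppling_graph N_i l l' c w) \<and> edges_cross a b} \<ge> 2"
    using p(3) by (simp add: crossings_def arcs_w)
  ultimately show ?thesis by blast
qed

end
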